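(* Let $$\tau=\left\{\begin{bmatrix}D&C\\C^*&F\end{bmatrix};\mathfrak M,\mathfrak M,\mathcal K\right\}$$ be a passive selfadjoint system with transfer function $\Omega$. Then for every $a\in(-1,1)$ the $\mathbf B(\mathfrak M)$-valued function $$z\mapsto\Omega\left(\frac{z+a}{1+az}\right),\qquad z\in\mathbb C\setminus\{(-\infty,-1]\cup[1,+\infty)\},$$ is the transfer function of the passive selfadjoint system $$\tau_a=\left\{\begin{bmatrix}\Omega(a)&\sqrt{1-a^2}\,C(I-aF)^{-1}\\ \sqrt{1-a^2}\,(I-aF)^{-1}C^*&F_a\end{bmatrix};\mathfrak M,\mathfrak M,\mathcal K\right\},\qquad F_a:=(F-aI)(I-aF)^{-1}.$$ Furthermore, if $\tau$ is a minimal system then $\tau_a$ is minimal, too.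
   Context: Hilbert spaces are complex and separable. Let $\mathcal E:=\mathbb C\setminus\{(-\infty,-1]\cup[1,+\infty)\}$. A passive selfadjoint system $\{T;\mathfrak M,\mathfrak M,\mathcal K\}$ is given by a selfadjoint contraction $T=\begin{bmatrix}D&C\\C^*&F\end{bmatrix}$ in $\mathfrak M\oplus\mathcal K$ (input-output space $\mathfrak M$, state space $\mathcal K$); its transfer function is $D+zC(I-zF)^{-1}C^*$, $z\in\mathcal E$; it is minimal if $\overline{\mathrm{span}}\{F^nC^*\mathfrak M:\ n\in\mathbb N_0\}=\mathcal K$. The claim includes that the block operator defining $\tau_a$ is a selfadjoint contraction. *)

theory Defs
  imports "HOL-Analysis.Analysis"
begin

section \<open>Complex Hilbert spaces\<close>

class complex_vector = ab_group_add +
  fixes scaleC :: "complex \<Rightarrow> 'a \<Rightarrow> 'a" (infixr \<open>*\<^sub>C\<close> 75)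
  assumes scaleC_add_right: "c *\<^sub>C (x + y) = c *\<^sub>C x + c *\<^sub>C y"
    and scaleC_add_left: "(c + d) *\<^sub>C x = c *\<^sub>C x + d *\<^sub>C x"
    and scaleC_scaleC: "c *\<^sub>C d *\<^sub>C x = (c * d) *\<^sub>C x"
    and scaleC_one: "1 *\<^sub>C x = x"

global_interpretation complex_vector: vector_space "scaleC :: complex \<Rightarrow> 'a \<Rightarrow> 'a :: complex_vector"
  defines cspan = complex_vector.span
  by unfold_locales (simp_all add: scaleC_add_right scaleC_add_left scaleC_scaleC scaleC_one)

text \<open>
  Positive definiteness of the complex inner product and its relation to the norm are
  inherited from \<^class>\<open>real_inner\<close>, whose inner product is the real part of \<open>cinner\<close>.
  The complex inner product is linear in the first argument.
\<close>

class complex_inner = complex_vector + real_inner +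
  fixes cinner :: "'a \<Rightarrow> 'a \<Rightarrow> complex"
  assumes scaleR_scaleC: "r *\<^sub>R x = complex_of_real r *\<^sub>C x"
    and cinner_commute: "cinner x y = cnj (cinner y x)"
    and cinner_add_left: "cinner (x + y) z = cinner x z + cinner y z"
    and cinner_scaleC_left: "cinner (c *\<^sub>C x) y = c * cinner x y"
    and inner_eq_Re_cinner: "inner x y = Re (cinner x y)"

class chilbert_space = complex_inner + complete_space

lemma cinner_scaleC_right: "cinner x (c *\<^sub>C y) = cnj c * cinner x y"
  for x :: "'a::complex_inner"
  by (metis cinner_commute cinner_scaleC_left complex_cnj_cnj complex_cnj_mult)

lemma cinner_eq_inner: "cinner x y = Complex (inner x y) (inner x (\<i> *\<^sub>C y))"
  for x :: "'a::complex_inner"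
  by (simp add: complex_eq_iff inner_eq_Re_cinner cinner_scaleC_right)

lemma cinner_extensionality:
  fixes x y :: "'a::complex_inner"
  assumes "\<And>z. cinner z x = cinner z y"
  shows "x = y"
proof -
  have "inner (x - y) x = inner (x - y) y"
    using assms by (simp add: inner_eq_Re_cinner)
  then have "inner (x - y) (x - y) = 0"
    by (simp add: inner_diff_right)
  then show ?thesis by simp
qed

lemma norm_scaleC: "norm (c *\<^sub>C x) = cmod c * norm x" for x :: "'a::complex_inner"
proof -
  have "cinner (c *\<^sub>C x) (c *\<^sub>C x) = complex_of_real ((cmod c)\<^sup>2) * cinner x x"
    unfolding complex_norm_square by (simp add: cinner_scaleC_left cinner_scaleC_right)
  then have "(norm (c *\<^sub>C x))\<^sup>2 = (cmod c * norm x)\<^sup>2"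
    by (simp add: power2_norm_eq_inner inner_eq_Re_cinner power_mult_distrib)
  then show ?thesis
    by (simp add: power2_eq_iff_nonneg)
qed

subsection \<open>Orthogonal sums\<close>

instantiation prod :: (complex_vector, complex_vector) complex_vector
begin
definition scaleC_prod where "c *\<^sub>C x = (c *\<^sub>C fst x, c *\<^sub>C snd x)"
instance
  by standard (simp_all add: scaleC_prod_def scaleC_add_right scaleC_add_left scaleC_scaleC scaleC_one)
end

instantiation prod :: (complex_inner, complex_inner) complex_inner
begin
definition cinner_prod where "cinner x y = cinner (fst x) (fst y) + cinner (snd x) (snd y)"
instance
proof
  fix r :: real and c :: complex and x y z :: "'a \<times> 'b"
  show "r *\<^sub>R x = complex_of_real r *\<^sub>C x"
    by (simp add: scaleR_prod_def scaleC_prod_def scaleR_scaleC)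
  show "cinner x y = cnj (cinner y x)"
    unfolding cinner_prod_def
    by (simp flip: cinner_commute[of "fst x" "fst y"] cinner_commute[of "snd x" "snd y"])
  show "cinner (x + y) z = cinner x z + cinner y z"
    by (simp add: cinner_prod_def cinner_add_left)
  show "cinner (c *\<^sub>C x) y = c * cinner x y"
    by (simp add: cinner_prod_def scaleC_prod_def cinner_scaleC_left distrib_left)
  show "inner x y = Re (cinner x y)"
    by (simp add: cinner_prod_def inner_prod_def inner_eq_Re_cinner)
qed
end

instance prod :: (chilbert_space, chilbert_space) chilbert_space ..

section \<open>Bounded operators\<close>

definition bounded_clinear :: "('a::complex_inner \<Rightarrow> 'b::complex_inner) \<Rightarrow> bool" where
  "bounded_clinear f \<longleftrightarrow> bounded_linear f \<and> (\<forall>c x. f (c *\<^sub>C x) = c *\<^sub>C f x)"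

lemma bounded_linear_scaleC: "bounded_linear (\<lambda>x :: 'a::complex_inner. c *\<^sub>C x)"
  by (rule bounded_linear_intro[where K = "cmod c"])
    (simp_all add: scaleC_add_right scaleR_scaleC scaleC_scaleC norm_scaleC mult.commute)

typedef (overloaded) ('a, 'b) cblinfun (\<open>(_ \<Rightarrow>\<^sub>C\<^sub>L /_)\<close> [22, 21] 21) =
  "{f :: 'a::complex_inner \<Rightarrow> 'b::complex_inner. bounded_clinear f}"
  morphisms cblinfun_apply CBlinfun
  by (rule exI[of _ "\<lambda>_. 0"]) (simp add: bounded_clinear_def)

notation cblinfun_apply (infixr \<open>*\<^sub>V\<close> 70)

setup_lifting type_definition_cblinfun

lemma cblinfun_eqI: "(\<And>x. A *\<^sub>V x = B *\<^sub>V x) \<Longrightarrow> A = B"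
  by (metis cblinfun_apply_inject ext)

lemma bounded_clinear_cblinfun_apply: "bounded_clinear (cblinfun_apply A)"
  using cblinfun_apply by blast

instantiation cblinfun :: (complex_inner, complex_inner) complex_vector
begin
lift_definition zero_cblinfun :: "'a \<Rightarrow>\<^sub>C\<^sub>L 'b" is "\<lambda>_. 0"
  by (simp add: bounded_clinear_def)
lift_definition plus_cblinfun :: "'a \<Rightarrow>\<^sub>C\<^sub>L 'b \<Rightarrow> 'a \<Rightarrow>\<^sub>C\<^sub>L 'b \<Rightarrow> 'a \<Rightarrow>\<^sub>C\<^sub>L 'b"
  is "\<lambda>f g x. f x + g x"
  by (simp add: bounded_clinear_def bounded_linear_add scaleC_add_right)
lift_definition uminus_cblinfun :: "'a \<Rightarrow>\<^sub>C\<^sub>L 'b \<Rightarrow> 'a \<Rightarrow>\<^sub>C\<^sub>L 'b" is "\<lambda>f x. - f x"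
  by (simp add: bounded_clinear_def bounded_linear_minus)
lift_definition minus_cblinfun :: "'a \<Rightarrow>\<^sub>C\<^sub>L 'b \<Rightarrow> 'a \<Rightarrow>\<^sub>C\<^sub>L 'b \<Rightarrow> 'a \<Rightarrow>\<^sub>C\<^sub>L 'b"
  is "\<lambda>f g x. f x - g x"
  by (simp add: bounded_clinear_def bounded_linear_sub complex_vector.scale_right_diff_distrib)
lift_definition scaleC_cblinfun :: "complex \<Rightarrow> 'a \<Rightarrow>\<^sub>C\<^sub>L 'b \<Rightarrow> 'a \<Rightarrow>\<^sub>C\<^sub>L 'b"
  is "\<lambda>c f x. c *\<^sub>C f x"
  unfolding bounded_clinear_def
  by (simp add: bounded_linear_compose[OF bounded_linear_scaleC] scaleC_scaleC mult.commute)
instance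
  by standard
    (transfer; simp add: scaleC_add_right scaleC_add_left scaleC_scaleC scaleC_one fun_eq_iff add_ac)+
end

lift_definition id_cblinfun :: "'a::complex_inner \<Rightarrow>\<^sub>C\<^sub>L 'a" is "\<lambda>x. x"
  by (simp add: bounded_clinear_def bounded_linear_ident)

lift_definition cblinfun_compose ::
  "'b::complex_inner \<Rightarrow>\<^sub>C\<^sub>L 'c::complex_inner \<Rightarrow> 'a::complex_inner \<Rightarrow>\<^sub>C\<^sub>L 'b \<Rightarrow> 'a \<Rightarrow>\<^sub>C\<^sub>L 'c"
  (infixl \<open>o\<^sub>C\<^sub>L\<close> 67) is "\<lambda>f g x. f (g x)"
  by (simp add: bounded_clinear_def bounded_linear_compose)

text \<open>The two-sided bounded inverse, unspecified for operators that are not invertible.\<close>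

definition cblinfun_inv :: "'a::complex_inner \<Rightarrow>\<^sub>C\<^sub>L 'a \<Rightarrow> 'a \<Rightarrow>\<^sub>C\<^sub>L 'a" where
  "cblinfun_inv A = (THE B. B o\<^sub>C\<^sub>L A = id_cblinfun \<and> A o\<^sub>C\<^sub>L B = id_cblinfun)"

lemma cblinfun_inv_eqI:
  assumes "B o\<^sub>C\<^sub>L A = id_cblinfun" "A o\<^sub>C\<^sub>L B = id_cblinfun"
  shows "cblinfun_inv A = B"
  unfolding cblinfun_inv_def
proof (rule the_equality)
  fix B' assume B': "B' o\<^sub>C\<^sub>L A = id_cblinfun \<and> A o\<^sub>C\<^sub>L B' = id_cblinfun"
  show "B' = B"
  proof (rule cblinfun_eqI)
    fix x
    have "B' *\<^sub>V x = B' *\<^sub>V (A o\<^sub>C\<^sub>L B) *\<^sub>V x"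
      by (simp add: assms id_cblinfun.rep_eq)
    also have "\<dots> = (B' o\<^sub>C\<^sub>L A) *\<^sub>V B *\<^sub>V x"
      by (simp add: cblinfun_compose.rep_eq)
    finally show "B' *\<^sub>V x = B *\<^sub>V x"
      using B' by (simp add: id_cblinfun.rep_eq)
  qed
qed (use assms in simp)

subsection \<open>Adjoints\<close>

definition cadjoint :: "'a::complex_inner \<Rightarrow>\<^sub>C\<^sub>L 'b::complex_inner \<Rightarrow> 'b \<Rightarrow>\<^sub>C\<^sub>L 'a"
  (\<open>_*\<close> [99] 100) where
  "cadjoint A = (THE B. \<forall>x y. cinner (A *\<^sub>V x) y = cinner x (B *\<^sub>V y))"

text \<open>Existence, by the Riesz representation theorem, which is not in the library.\<close>

lemma riesz_representation_real:
  fixes g :: "'a::{real_inner, complete_space} \<Rightarrow> real"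
  assumes "bounded_linear g"
  shows "\<exists>v. \<forall>x. g x = inner x v"
proof -
  interpret g: bounded_linear g by fact
  define J where "J = (\<lambda>x. inner x x - 2 * g x)"
  obtain K where K: "\<And>x. norm (g x) \<le> norm x * K"
    using g.bounded by blast
  have lower: "- (K\<^sup>2) \<le> J x" for x
  proof -
    have "0 \<le> (norm x - K)\<^sup>2" by simp
    then show ?thesis
      using K[of x] unfolding J_def
      by (simp add: power2_diff power2_norm_eq_inner algebra_simps abs_le_iff)
  qed
  define m where "m = Inf (range J)"
  have bdd: "bdd_below (range J)"
    using lower by (intro bdd_belowI[of _ "- (K\<^sup>2)"]) auto
  have m_le: "m \<le> J x" for x
    unfolding m_def using bdd by (intro cInf_lower) auto
  have "\<exists>x. J x < m + 1 / real (Suc n)" for n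
  proof -
    have "Inf (range J) < m + 1 / real (Suc n)" unfolding m_def by simp
    then show ?thesis
      using bdd by (subst (asm) cInf_less_iff) auto
  qed
  then obtain X where X: "\<And>n. J (X n) < m + 1 / real (Suc n)" by metis
  have par: "(norm (x - y))\<^sup>2 = 2 * (J x + J y - 2 * J ((1/2) *\<^sub>R (x + y)))" for x y
    unfolding J_def power2_norm_eq_inner
    by (simp add: g.scaleR g.add inner_add_left inner_add_right inner_diff_left inner_diff_right
        inner_commute algebra_simps)
  have "Cauchy X"
  proof (rule metric_CauchyI)
    fix e :: real assume e: "0 < e"
    obtain N :: nat where N: "4 / e\<^sup>2 < real N"
      using reals_Archimedean2 by blast
    show "\<exists>M. \<forall>i\<ge>M. \<forall>j\<ge>M. dist (X i) (X j) < e"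
    proof (intro exI allI impI)
      fix i j assume ij: "N \<le> i" "N \<le> j"
      have N0: "0 < real N"
        using N e by (smt (verit) divide_nonneg_nonneg zero_le_power2)
      have *: "J (X k) < m + 1 / real N" if "N \<le> k" for k
      proof -
        have "1 / real (Suc k) \<le> 1 / real N"
          using that N0 by (intro divide_left_mono) auto
        then show ?thesis using X[of k] by linarith
      qed
      have "(norm (X i - X j))\<^sup>2 < 4 / real N"
        using par[of "X i" "X j"] *[OF ij(1)] *[OF ij(2)] m_le[of "(1/2) *\<^sub>R (X i + X j)"]
        by (simp add: field_simps)
      also have "\<dots> < e\<^sup>2"
        using N N0 e by (simp add: field_simps)
      finally show "dist (X i) (X j) < e"
        using e by (simp add: dist_norm power2_less_imp_less)
    qed
  qed
  then obtain v where v: "X \<longlonglongrightarrow> v"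
    using Cauchy_convergent convergent_def by blast
  have "(\<lambda>n. J (X n)) \<longlonglongrightarrow> J v"
    unfolding J_def by (intro tendsto_intros g.tendsto v)
  moreover have "(\<lambda>n. m + 1 / real (Suc n)) \<longlonglongrightarrow> m + 0"
    by (intro tendsto_intros LIMSEQ_inverse_real_of_nat[unfolded inverse_eq_divide])
  ultimately have "J v \<le> m"
    using X by (intro LIMSEQ_le[of "\<lambda>n. J (X n)" _ "\<lambda>n. m + 1 / real (Suc n)"])
      (auto intro: less_imp_le)
  then have min: "J v \<le> J y" for y using m_le[of y] by linarith
  have "g x = inner x v" for x
  proof (cases "x = 0")
    case False
    define d where "d = inner x v - g x"
    define q where "q = inner x x"
    have q: "0 < q" using False by (simp add: q_def)
    have "J (v + t *\<^sub>R x) - J v = t\<^sup>2 * q + 2 * t * d" for t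
      unfolding J_def d_def q_def
      by (simp add: g.add g.scaleR inner_add_left inner_add_right inner_commute power2_eq_square
          algebra_simps)
    from this[of "- d / q"]
    have "J (v + (- d / q) *\<^sub>R x) - J v = (- d / q)\<^sup>2 * q + 2 * (- d / q) * d" .
    also have "\<dots> = - (d\<^sup>2 / q)"
      using q by (simp add: field_simps power2_eq_square)
    finally have "d\<^sup>2 / q \<le> 0"
      using min[of "v + (- d / q) *\<^sub>R x"] by linarith
    then have "d = 0"
      using q by (simp add: divide_le_0_iff)
    then show ?thesis by (simp add: d_def)
  qed (simp add: g.zero)
  then show ?thesis by blast
qed

lemma cadjoint_exists:
  fixes A :: "'a::chilbert_space \<Rightarrow>\<^sub>C\<^sub>L 'b::complex_inner"
  shows "\<exists>B. \<forall>x y. cinner (A *\<^sub>V x) y = cinner x (B *\<^sub>V y)"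
proof -
  have A: "bounded_linear (cblinfun_apply A)" "\<And>c x. A *\<^sub>V (c *\<^sub>C x) = c *\<^sub>C (A *\<^sub>V x)"
    using bounded_clinear_cblinfun_apply[of A] by (auto simp: bounded_clinear_def)
  have "\<exists>v. \<forall>x. inner (A *\<^sub>V x) y = inner x v" for y
    by (rule riesz_representation_real)
      (rule bounded_linear_compose[OF bounded_linear_inner_left A(1)])
  then obtain f where f: "\<And>x y. inner (A *\<^sub>V x) y = inner x (f y)"
    by metis
  have cf: "cinner (A *\<^sub>V x) y = cinner x (f y)" for x y
  proof -
    have "Im (cinner (A *\<^sub>V x) y) = - Re (cinner (A *\<^sub>V (\<i> *\<^sub>C x)) y)"
      by (simp add: A cinner_scaleC_left)
    also have "\<dots> = - Re (cinner (\<i> *\<^sub>C x) (f y))"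
      using f[of "\<i> *\<^sub>C x" y] by (simp add: inner_eq_Re_cinner)
    also have "\<dots> = Im (cinner x (f y))"
      by (simp add: cinner_scaleC_left)
    finally show ?thesis
      using f[of x y] by (simp add: complex_eq_iff inner_eq_Re_cinner)
  qed
  have cadd: "cinner z (x + y) = cinner z x + cinner z y" for x y z :: "'c::complex_inner"
    by (metis cinner_add_left cinner_commute complex_cnj_add)
  have add: "f (x + y) = f x + f y" for x y
    by (rule cinner_extensionality) (simp add: cadd flip: cf)
  have scale: "f (c *\<^sub>C x) = c *\<^sub>C f x" for c x
    by (rule cinner_extensionality) (simp add: cinner_scaleC_right flip: cf)
  obtain K where K: "\<And>x. norm (A *\<^sub>V x) \<le> norm x * K" "0 < K"
    using bounded_linear.pos_bounded[OF A(1)] by blast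
  have bound: "norm (f y) \<le> norm y * K" for y
  proof (cases "f y = 0")
    case False
    have "norm (f y) * norm (f y) = inner (A *\<^sub>V f y) y"
      by (simp add: f flip: power2_norm_eq_inner power2_eq_square)
    also have "\<dots> \<le> norm (A *\<^sub>V f y) * norm y"
      by (rule norm_cauchy_schwarz)
    also have "\<dots> \<le> norm (f y) * K * norm y"
      by (intro mult_right_mono K) simp
    finally show ?thesis
      using False by (simp add: mult_ac)
  qed (use K(2) in simp)
  have "bounded_clinear f"
    unfolding bounded_clinear_def
    by (auto simp: scale scaleR_scaleC add intro!: bounded_linear_intro bound)
  then show ?thesis
    using cf by (intro exI[of _ "CBlinfun f"]) (simp add: CBlinfun_inverse)
qed

lemma cadjoint_eqI:
  assumes "\<And>x y. cinner (A *\<^sub>V x) y = cinner x (B *\<^sub>V y)"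
  shows "A* = B"
  unfolding cadjoint_def
proof (rule the_equality)
  fix B' assume B': "\<forall>x y. cinner (A *\<^sub>V x) y = cinner x (B' *\<^sub>V y)"
  show "B' = B"
    by (intro cblinfun_eqI cinner_extensionality) (simp flip: assms B'[rule_format])
qed (simp add: assms)

lemma cinner_cadjoint: "cinner (A *\<^sub>V x) y = cinner x (A* *\<^sub>V y)"
  for A :: "'a::chilbert_space \<Rightarrow>\<^sub>C\<^sub>L 'b::complex_inner"
  using cadjoint_exists[of A] cadjoint_eqI[of A] by metis

definition selfadjoint :: "'a::complex_inner \<Rightarrow>\<^sub>C\<^sub>L 'a \<Rightarrow> bool" where
  "selfadjoint A \<longleftrightarrow> A* = A"

definition contraction :: "'a::complex_inner \<Rightarrow>\<^sub>C\<^sub>L 'b::complex_inner \<Rightarrow> bool" where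
  "contraction A \<longleftrightarrow> (\<forall>x. norm (A *\<^sub>V x) \<le> norm x)"

section \<open>Passive selfadjoint systems\<close>

text \<open>\<open>System D C B F\<close> stands for the block operator with rows \<open>(D, C)\<close> and \<open>(B, F)\<close>.\<close>

declare [[typedef_overloaded]]

datatype ('m::complex_inner, 'k::complex_inner) system =
  System "'m \<Rightarrow>\<^sub>C\<^sub>L 'm" "'k \<Rightarrow>\<^sub>C\<^sub>L 'm" "'m \<Rightarrow>\<^sub>C\<^sub>L 'k" "'k \<Rightarrow>\<^sub>C\<^sub>L 'k"

lift_definition block_operator ::
  "'m::complex_inner \<Rightarrow>\<^sub>C\<^sub>L 'm \<Rightarrow> 'k::complex_inner \<Rightarrow>\<^sub>C\<^sub>L 'm \<Rightarrow> 'm \<Rightarrow>\<^sub>C\<^sub>L 'k \<Rightarrow> 'k \<Rightarrow>\<^sub>C\<^sub>L 'k \<Rightarrow>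
    ('m \<times> 'k) \<Rightarrow>\<^sub>C\<^sub>L ('m \<times> 'k)"
  is "\<lambda>D C B F x. (D (fst x) + C (snd x), B (fst x) + F (snd x))"
proof -
  fix D :: "'m \<Rightarrow> 'm" and C :: "'k \<Rightarrow> 'm" and B :: "'m \<Rightarrow> 'k" and F :: "'k \<Rightarrow> 'k"
  assume *: "bounded_clinear D" "bounded_clinear C" "bounded_clinear B" "bounded_clinear F"
  then have "bounded_linear (\<lambda>x::'m \<times> 'k. D (fst x))" "bounded_linear (\<lambda>x::'m \<times> 'k. C (snd x))"
      "bounded_linear (\<lambda>x::'m \<times> 'k. B (fst x))" "bounded_linear (\<lambda>x::'m \<times> 'k. F (snd x))"
    by (simp_all add: bounded_clinear_def bounded_linear_compose[OF _ bounded_linear_fst]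
        bounded_linear_compose[OF _ bounded_linear_snd])
  then show "bounded_clinear (\<lambda>x. (D (fst x) + C (snd x), B (fst x) + F (snd x)))"
    using * unfolding bounded_clinear_def
    by (simp add: bounded_linear_Pair bounded_linear_add scaleC_prod_def scaleC_add_right)
qed

fun system_operator :: "('m::complex_inner, 'k::complex_inner) system \<Rightarrow> ('m \<times> 'k) \<Rightarrow>\<^sub>C\<^sub>L ('m \<times> 'k)" where
  "system_operator (System D C B F) = block_operator D C B F"

definition passive_selfadjoint_system :: "('m::complex_inner, 'k::complex_inner) system \<Rightarrow> bool" where
  "passive_selfadjoint_system \<tau> \<longleftrightarrow>
    selfadjoint (system_operator \<tau>) \<and> contraction (system_operator \<tau>)"

definition \<E> :: "complex set" where
  "\<E> = - (complex_of_real ` ({..-1} \<union> {1..}))"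

fun transfer_function :: "('m::complex_inner, 'k::complex_inner) system \<Rightarrow> complex \<Rightarrow> 'm \<Rightarrow>\<^sub>C\<^sub>L 'm" where
  "transfer_function (System D C B F) z =
    D + z *\<^sub>C (C o\<^sub>C\<^sub>L cblinfun_inv (id_cblinfun - z *\<^sub>C F) o\<^sub>C\<^sub>L B)"

text \<open>
  The transfer function has domain \<open>\<E>\<close>; the values outside \<open>\<E>\<close> of a function
  representing it are left unspecified.
\<close>

definition is_transfer_function ::
  "(complex \<Rightarrow> 'm \<Rightarrow>\<^sub>C\<^sub>L 'm) \<Rightarrow> ('m::complex_inner, 'k::complex_inner) system \<Rightarrow> bool" where
  "is_transfer_function \<Omega> \<tau> \<longleftrightarrow> (\<forall>z\<in>\<E>. \<Omega> z = transfer_function \<tau> z)"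

text \<open>For a selfadjoint system the lower left entry \<open>B\<close> is the adjoint of \<open>C\<close>.\<close>

fun minimal_system :: "('m::complex_inner, 'k::complex_inner) system \<Rightarrow> bool" where
  "minimal_system (System D C B F) \<longleftrightarrow>
    closure (cspan (\<Union>n::nat. range (\<lambda>u. (cblinfun_apply F ^^ n) (B *\<^sub>V u)))) = UNIV"

end

theory Submission
  imports Defs
begin

text \<open>
  Let \<open>R\<close> be the inverse of \<open>I - a F\<close> and \<open>r = sqrt (1 - a\<^sup>2)\<close>. For an input \<open>u\<close> and a
  state \<open>v\<close> of \<open>\<tau>\<^sub>a\<close>, put \<open>x = R (a C* u + r v)\<close> and \<open>p = C* u + F x\<close>. Then \<open>\<tau>\<close> maps \<open>(u, x)\<close> to \<open>(y, p)\<close> and \<open>\<tau>\<^sub>a\<close> maps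
  \<open>(u, v)\<close> to \<open>(y, q)\<close> with the same output \<open>y\<close>, and the states are linked by the unitary relation
  \<open>x = a p + r v\<close>, \<open>q = r p - a v\<close>. Unitarity carries contractivity over from \<open>\<tau>\<close> to \<open>\<tau>\<^sub>a\<close>, and
  \<open>v = z q\<close> forces \<open>x = (z + a) / (1 + a z) p\<close>, which identifies the transfer functions.
  For minimality, \<open>I + a F\<^sub>a = (1 - a\<^sup>2) R\<close> shows that the closed span \<open>L\<close> of the states reachable
  by \<open>\<tau>\<^sub>a\<close> is invariant under \<open>R\<close> and, since \<open>\<bar>a\<bar> < 1\<close>, under the inverse of \<open>R\<close>; hence \<open>L\<close> is
  invariant under \<open>F\<close> and contains the range of \<open>C*\<close>.
\<close>

section \<open>Linearity of operators and sesquilinearity of the inner product\<close>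

lemma cblinfun_apply_add: "A *\<^sub>V (x + y) = A *\<^sub>V x + A *\<^sub>V y"
  using bounded_clinear_cblinfun_apply[of A]
  by (simp add: bounded_clinear_def bounded_linear.linear linear_add)

lemma cblinfun_apply_diff: "A *\<^sub>V (x - y) = A *\<^sub>V x - A *\<^sub>V y"
  using bounded_clinear_cblinfun_apply[of A]
  by (simp add: bounded_clinear_def bounded_linear.linear linear_diff)

lemma cblinfun_apply_zero: "A *\<^sub>V 0 = 0"
  using cblinfun_apply_diff[of A 0 0] by simp

lemma cblinfun_apply_scaleC: "A *\<^sub>V (c *\<^sub>C x) = c *\<^sub>C (A *\<^sub>V x)"
  using bounded_clinear_cblinfun_apply[of A] by (simp add: bounded_clinear_def)

lemma bounded_linear_cblinfun_apply: "bounded_linear (cblinfun_apply A)"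
  using bounded_clinear_cblinfun_apply[of A] by (simp add: bounded_clinear_def)

lemmas cblinfun_linear = cblinfun_apply_add cblinfun_apply_diff cblinfun_apply_scaleC

lemmas cblinfun_rep_eqs = zero_cblinfun.rep_eq plus_cblinfun.rep_eq minus_cblinfun.rep_eq
  scaleC_cblinfun.rep_eq id_cblinfun.rep_eq cblinfun_compose.rep_eq

lemmas scaleC_algebra = scaleC_add_right scaleC_add_left scaleC_scaleC
  complex_vector.scale_right_diff_distrib complex_vector.scale_left_diff_distrib

lemma cinner_add_right: "cinner x (y + z) = cinner x y + cinner x z"
  for x :: "'a::complex_inner"
  by (metis cinner_add_left cinner_commute complex_cnj_add)

lemma cinner_diff_left: "cinner (x - y) z = cinner x z - cinner y z"
  for x :: "'a::complex_inner"
  by (metis add_diff_cancel cinner_add_left diff_add_cancel)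

lemma cinner_diff_right: "cinner x (y - z) = cinner x y - cinner x z"
  for x :: "'a::complex_inner"
  by (metis add_diff_cancel cinner_add_right diff_add_cancel)

lemma cinner_zero_left: "cinner 0 x = 0" for x :: "'a::complex_inner"
  using cinner_diff_left[of 0 0 x] by simp

lemma cinner_zero_right: "cinner x 0 = 0" for x :: "'a::complex_inner"
  using cinner_diff_right[of x 0 0] by simp

lemmas cinner_algebra = cinner_add_left cinner_add_right cinner_diff_left cinner_diff_right
  cinner_scaleC_left cinner_scaleC_right cinner_zero_left cinner_zero_right

lemma cinner_cadjoint_left: "cinner (A* *\<^sub>V x) y = cinner x (A *\<^sub>V y)"
  for A :: "'a::chilbert_space \<Rightarrow>\<^sub>C\<^sub>L 'b::complex_inner"
  by (metis cinner_cadjoint cinner_commute)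

lemma selfadjoint_iff: "selfadjoint A \<longleftrightarrow> (\<forall>x y. cinner (A *\<^sub>V x) y = cinner x (A *\<^sub>V y))"
  for A :: "'a::chilbert_space \<Rightarrow>\<^sub>C\<^sub>L 'a"
  unfolding selfadjoint_def using cadjoint_eqI cinner_cadjoint by metis

section \<open>Invertibility and resolvents\<close>

text \<open>As in the Lax-Milgram theorem: for a suitable t > 0 the map x - t (A x - y) is a strict
  contraction in x, and its fixed point solves A x = y. Coercivity makes the solution unique and
  bounds the inverse by 1 / c.\<close>

lemma coercive_invertible:
  fixes A :: "'a::chilbert_space \<Rightarrow>\<^sub>C\<^sub>L 'a"
  assumes "0 < c" and coercive: "\<And>x. c * (norm x)\<^sup>2 \<le> inner (A *\<^sub>V x) x"
  shows "\<exists>B. B o\<^sub>C\<^sub>L A = id_cblinfun \<and> A o\<^sub>C\<^sub>L B = id_cblinfun"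
proof -
  obtain K0 where K0: "\<And>x. norm (A *\<^sub>V x) \<le> norm x * K0" "0 < K0"
    using bounded_linear.pos_bounded[OF bounded_linear_cblinfun_apply] by blast
  \<comment> \<open>Adding \<open>c\<close> to the bound ensures \<open>c < K\<close>, so that
    \<open>q\<close> below is the root of a number strictly between 0 and 1.\<close>
  define K where "K = K0 + c"
  have K: "norm (A *\<^sub>V x) \<le> norm x * K" for x
  proof -
    have "norm x * K0 \<le> norm x * K"
      using \<open>0 < c\<close> by (intro mult_left_mono) (auto simp: K_def)
    then show ?thesis using K0(1)[of x] by linarith
  qed
  have "0 < K" "c < K" using K0(2) \<open>0 < c\<close> by (auto simp: K_def)
  define q where "q = sqrt (1 - c\<^sup>2 / K\<^sup>2)"
  have cK: "c\<^sup>2 / K\<^sup>2 < 1" "0 < c\<^sup>2 / K\<^sup>2"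
    using power_strict_mono[of c K 2] \<open>0 < c\<close> \<open>c < K\<close> by simp_all
  then have q: "0 \<le> q" "q < 1" "q\<^sup>2 = 1 - c\<^sup>2 / K\<^sup>2"
    by (auto simp: q_def)
  \<comment> \<open>This \<open>t\<close> minimizes 1 - 2 t c + t^2 K^2, and the minimum is
    q^2.\<close>
  define t where "t = c / K\<^sup>2"
  have t: "0 < t" using \<open>0 < c\<close> \<open>0 < K\<close> by (simp add: t_def)
  have bound: "norm (d - t *\<^sub>R (A *\<^sub>V d)) \<le> q * norm d" for d
  proof (rule power2_le_imp_le)
    have "(norm (d - t *\<^sub>R (A *\<^sub>V d)))\<^sup>2
        = (norm d)\<^sup>2 - 2 * t * inner (A *\<^sub>V d) d + t\<^sup>2 * (norm (A *\<^sub>V d))\<^sup>2"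
      unfolding power2_norm_eq_inner
      by (simp add: inner_diff_left inner_diff_right inner_commute
          power2_eq_square algebra_simps)
    also have "\<dots> \<le> (norm d)\<^sup>2 - 2 * t * (c * (norm d)\<^sup>2) + t\<^sup>2 * (norm d * K)\<^sup>2"
      using t by (intro add_mono diff_mono mult_left_mono power_mono K coercive) auto
    also have "\<dots> = (q * norm d)\<^sup>2"
      unfolding power_mult_distrib q t_def using \<open>0 < K\<close>
      by (simp add: field_simps power2_eq_square)
    finally show "(norm (d - t *\<^sub>R (A *\<^sub>V d)))\<^sup>2 \<le> (q * norm d)\<^sup>2" .
  qed (use q in simp)
  have "\<exists>x. A *\<^sub>V x = y" for y
  proof -
    let ?f = "\<lambda>x. x - t *\<^sub>R (A *\<^sub>V x - y)"
    have "dist (?f x) (?f x') \<le> q * dist x x'" for x x'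
    proof -
      have "?f x - ?f x' = (x - x') - t *\<^sub>R (A *\<^sub>V (x - x'))"
        by (simp add: cblinfun_linear algebra_simps)
      then show ?thesis using bound[of "x - x'"] by (metis dist_norm)
    qed
    then have "\<exists>!x\<in>UNIV. ?f x = x"
      using q by (intro Banach_fix[where c = q] complete_UNIV) auto
    then show ?thesis using t by auto
  qed
  then obtain g where g: "\<And>y. A *\<^sub>V g y = y" by metis
  have below: "c * norm x \<le> norm (A *\<^sub>V x)" for x
  proof (cases "x = 0")
    case False
    have "c * norm x * norm x \<le> norm (A *\<^sub>V x) * norm x"
      using coercive[of x] norm_cauchy_schwarz[of "A *\<^sub>V x" x] by (simp add: power2_eq_square)
    then show ?thesis using False by simp
  qed simp
  have inj: "x = x'" if "A *\<^sub>V x = A *\<^sub>V x'" for x x'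
    using below[of "x - x'"] that \<open>0 < c\<close> by (simp add: cblinfun_linear mult_le_0_iff)
  have g_scaleC: "g (s *\<^sub>C y) = s *\<^sub>C g y" for s y
    by (rule inj) (simp add: cblinfun_linear g)
  have "bounded_clinear g"
    unfolding bounded_clinear_def
  proof (intro conjI allI g_scaleC bounded_linear_intro[where K = "1 / c"])
    show "g (x + y) = g x + g y" for x y
      by (rule inj) (simp add: cblinfun_linear g)
    show "norm (g x) \<le> norm x * (1 / c)" for x
      using below[of "g x"] \<open>0 < c\<close> by (simp add: g field_simps)
  qed (simp add: scaleR_scaleC g_scaleC)
  then have apply_g: "CBlinfun g *\<^sub>V x = g x" for x
    by (simp add: CBlinfun_inverse)
  have "CBlinfun g o\<^sub>C\<^sub>L A = id_cblinfun" "A o\<^sub>C\<^sub>L CBlinfun g = id_cblinfun"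
    by (rule cblinfun_eqI; simp add: cblinfun_rep_eqs apply_g g inj)+
  then show ?thesis by blast
qed

lemma mem_\<E>_iff: "z \<in> \<E> \<longleftrightarrow> Im z \<noteq> 0 \<or> \<bar>Re z\<bar> < 1"
proof -
  have "z \<in> complex_of_real ` S \<longleftrightarrow> Im z = 0 \<and> Re z \<in> S" for S
    by (auto simp: complex_eq_iff image_iff)
  then show ?thesis unfolding \<E>_def by auto
qed

text \<open>
  The numerical range of \<open>I - z F\<close> lies in the segment from \<open>1 - z\<close> to \<open>1 + z\<close>, which avoids the
  origin, so a rotation by a suitable \<open>u\<close> makes the operator coercive.
\<close>

lemma resolvent_exists:
  fixes F :: "'k::chilbert_space \<Rightarrow>\<^sub>C\<^sub>L 'k"
  assumes "selfadjoint F" "contraction F" "z \<in> \<E>"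
  shows "\<exists>B. B o\<^sub>C\<^sub>L (id_cblinfun - z *\<^sub>C F) = id_cblinfun \<and>
    (id_cblinfun - z *\<^sub>C F) o\<^sub>C\<^sub>L B = id_cblinfun"
proof -
  obtain u where u: "\<bar>Re (u * z)\<bar> < Re u"
  proof (cases "Im z = 0")
    case True
    then show ?thesis using assms(3) that[of 1] by (simp add: mem_\<E>_iff)
  next
    case False
    \<comment> \<open>For this u the product u z is purely imaginary, while Re u = (Im z)^2 >
      0.\<close>
    then show ?thesis using that[of "\<i> * of_real (Im z) * cnj z"]
      by (auto simp: zero_less_mult_iff neq_iff)
  qed
  let ?A = "id_cblinfun - z *\<^sub>C F"
  have "\<exists>B. B o\<^sub>C\<^sub>L (u *\<^sub>C ?A) = id_cblinfun \<and> (u *\<^sub>C ?A) o\<^sub>C\<^sub>L B = id_cblinfun"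
  proof (rule coercive_invertible)
    show "0 < Re u - \<bar>Re (u * z)\<bar>" using u by simp
    fix x
    \<comment> \<open>Selfadjointness makes the quadratic form of \<open>F\<close> real, so only Re
      (u z) multiplies it in the real part; contractivity bounds it by the squared norm of
      \<open>x\<close>.\<close>
    define \<phi> where "\<phi> = inner (F *\<^sub>V x) x"
    have "cinner (F *\<^sub>V x) x = cnj (cinner (F *\<^sub>V x) x)"
      using assms(1) by (metis cinner_commute selfadjoint_iff)
    then have F: "cinner (F *\<^sub>V x) x = of_real \<phi>"
      by (simp add: \<phi>_def inner_eq_Re_cinner complex_eq_iff)
    have x: "cinner x x = of_real ((norm x)\<^sup>2)"
      unfolding power2_norm_eq_inner inner_eq_Re_cinner
      using cinner_commute[of x x] by (simp add: complex_eq_iff)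
    have "\<bar>\<phi>\<bar> \<le> norm (F *\<^sub>V x) * norm x"
      unfolding \<phi>_def by (rule Cauchy_Schwarz_ineq2)
    also have "\<dots> \<le> norm x * norm x"
      using assms(2) by (intro mult_right_mono) (auto simp: contraction_def)
    finally have "\<bar>\<phi>\<bar> \<le> (norm x)\<^sup>2" by (simp add: power2_eq_square)
    then have "\<bar>Re (u * z) * \<phi>\<bar> \<le> \<bar>Re (u * z)\<bar> * (norm x)\<^sup>2"
      unfolding abs_mult by (rule mult_left_mono) simp
    moreover have "cinner ((u *\<^sub>C ?A) *\<^sub>V x) x = u * of_real ((norm x)\<^sup>2) - u * z * of_real \<phi>"
      by (simp add: cblinfun_rep_eqs cinner_algebra F x algebra_simps del: of_real_power)
    then have "inner ((u *\<^sub>C ?A) *\<^sub>V x) x = Re u * (norm x)\<^sup>2 - Re (u * z) * \<phi>"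
      by (simp add: inner_eq_Re_cinner del: of_real_power)
    ultimately show "(Re u - \<bar>Re (u * z)\<bar>) * (norm x)\<^sup>2 \<le> inner ((u *\<^sub>C ?A) *\<^sub>V x) x"
      unfolding left_diff_distrib by linarith
  qed
  then obtain B where B: "B o\<^sub>C\<^sub>L (u *\<^sub>C ?A) = id_cblinfun" "(u *\<^sub>C ?A) o\<^sub>C\<^sub>L B = id_cblinfun"
    by blast
  have "(u *\<^sub>C B) o\<^sub>C\<^sub>L ?A = B o\<^sub>C\<^sub>L (u *\<^sub>C ?A)" "?A o\<^sub>C\<^sub>L (u *\<^sub>C B) = (u *\<^sub>C ?A) o\<^sub>C\<^sub>L B"
    by (rule cblinfun_eqI; simp add: cblinfun_rep_eqs cblinfun_linear scaleC_algebra mult.commute)+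
  then show ?thesis using B by metis
qed

lemma
  fixes F :: "'k::chilbert_space \<Rightarrow>\<^sub>C\<^sub>L 'k"
  assumes "selfadjoint F" "contraction F" "z \<in> \<E>"
  shows resolvent_left: "cblinfun_inv (id_cblinfun - z *\<^sub>C F) *\<^sub>V (x - z *\<^sub>C (F *\<^sub>V x)) = x"
    and resolvent_right: "cblinfun_inv (id_cblinfun - z *\<^sub>C F) *\<^sub>V x
      - z *\<^sub>C (F *\<^sub>V cblinfun_inv (id_cblinfun - z *\<^sub>C F) *\<^sub>V x) = x"
proof -
  obtain B where B: "B o\<^sub>C\<^sub>L (id_cblinfun - z *\<^sub>C F) = id_cblinfun"
      "(id_cblinfun - z *\<^sub>C F) o\<^sub>C\<^sub>L B = id_cblinfun"
    using resolvent_exists[OF assms] by blast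
  have "B *\<^sub>V (x - z *\<^sub>C (F *\<^sub>V x)) = x" "B *\<^sub>V x - z *\<^sub>C (F *\<^sub>V B *\<^sub>V x) = x"
    using arg_cong[OF B(1), of "\<lambda>A. A *\<^sub>V x"] arg_cong[OF B(2), of "\<lambda>A. A *\<^sub>V x"]
    by (simp_all add: cblinfun_rep_eqs)
  then show "cblinfun_inv (id_cblinfun - z *\<^sub>C F) *\<^sub>V (x - z *\<^sub>C (F *\<^sub>V x)) = x"
      "cblinfun_inv (id_cblinfun - z *\<^sub>C F) *\<^sub>V x
        - z *\<^sub>C (F *\<^sub>V cblinfun_inv (id_cblinfun - z *\<^sub>C F) *\<^sub>V x) = x"
    by (simp_all add: cblinfun_inv_eqI[OF B])
qed

text \<open>Vectors with one zero component isolate the diagonal entries, and projecting onto the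
  state space does not increase the norm.\<close>

lemma passive_selfadjoint_systemD:
  fixes D :: "'m::chilbert_space \<Rightarrow>\<^sub>C\<^sub>L 'm" and F :: "'k::chilbert_space \<Rightarrow>\<^sub>C\<^sub>L 'k"
  assumes "passive_selfadjoint_system (System D C B F)"
  shows "selfadjoint D" "selfadjoint F" "contraction F"
proof -
  let ?T = "block_operator D C B F"
  have sym: "cinner (?T *\<^sub>V p) q = cinner p (?T *\<^sub>V q)" for p q
    using assms unfolding passive_selfadjoint_system_def selfadjoint_iff system_operator.simps
    by blast
  show "selfadjoint D" "selfadjoint F"
    unfolding selfadjoint_iff
    using sym[of "(_, 0)" "(_, 0)"] sym[of "(0, _)" "(0, _)"]
    by (simp_all add: block_operator.rep_eq cinner_prod_def cinner_algebra cblinfun_apply_zero)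
  show "contraction F"
    unfolding contraction_def
  proof
    fix x
    have "norm (?T *\<^sub>V (0, x)) \<le> norm (0 :: 'm, x)"
      using assms unfolding passive_selfadjoint_system_def contraction_def system_operator.simps
      by blast
    moreover have "norm (F *\<^sub>V x) \<le> norm (?T *\<^sub>V (0, x))"
      using norm_snd_le[of "F *\<^sub>V x" "C *\<^sub>V x"]
      by (simp add: block_operator.rep_eq cblinfun_apply_zero)
    ultimately show "norm (F *\<^sub>V x) \<le> norm x" by (simp add: norm_prod_def)
  qed
qed

section \<open>Closed invariant subspaces\<close>

lemma subspace_closure_cspan:
  fixes S :: "'a::complex_inner set"
  shows "complex_vector.subspace (closure (cspan S))"
proof (rule complex_vector.subspaceI)
  show "0 \<in> closure (cspan S)"
    using closure_subset complex_vector.span_zero by blast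
next
  fix x y assume "x \<in> closure (cspan S)" "y \<in> closure (cspan S)"
  then obtain X Y where "\<forall>n. X n \<in> cspan S" "X \<longlonglongrightarrow> x" "\<forall>n. Y n \<in> cspan S" "Y \<longlonglongrightarrow> y"
    unfolding closure_sequential by blast
  then show "x + y \<in> closure (cspan S)"
    unfolding closure_sequential
    by (intro exI[of _ "\<lambda>n. X n + Y n"]) (auto intro: complex_vector.span_add tendsto_add)
next
  fix c :: complex and x assume "x \<in> closure (cspan S)"
  then obtain X where "\<forall>n. X n \<in> cspan S" "X \<longlonglongrightarrow> x"
    unfolding closure_sequential by blast
  then show "c *\<^sub>C x \<in> closure (cspan S)"
    unfolding closure_sequential
    by (intro exI[of _ "\<lambda>n. c *\<^sub>C X n"])
      (auto intro: complex_vector.span_scale bounded_linear.tendsto[OF bounded_linear_scaleC])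
qed

text \<open>Linearity carries invariance from \<open>S\<close> to its span, and continuity from the
  span to its closure.\<close>

lemma invariant_closure_cspan:
  assumes "\<And>x. x \<in> S \<Longrightarrow> A *\<^sub>V x \<in> S" and x: "x \<in> closure (cspan S)"
  shows "A *\<^sub>V x \<in> closure (cspan S)"
proof -
  have "A *\<^sub>V y \<in> cspan S" if "y \<in> cspan S" for y
    using that
  proof (induction rule: complex_vector.span_induct_alt)
    case base
    show ?case by (simp add: cblinfun_apply_zero complex_vector.span_zero)
  next
    case (step c y z)
    then show ?case
      by (simp add: cblinfun_linear complex_vector.span_add complex_vector.span_scale
          complex_vector.span_base assms(1))
  qed
  then have "cblinfun_apply A ` closure (cspan S) \<subseteq> closure (cspan S)"
    using closure_subset
    by (intro image_closure_subset linear_continuous_on bounded_linear_cblinfun_apply) blast+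
  then show ?thesis using x by blast
qed

text \<open>The iteration \<open>x \<mapsto> w - c G x\<close> stays in \<open>L\<close> and converges to the solution of \<open>x + c G x = w\<close>.\<close>

lemma mem_invariant_subspace:
  fixes G :: "'a::chilbert_space \<Rightarrow>\<^sub>C\<^sub>L 'a"
  assumes L: "closed L" "complex_vector.subspace L" and inv: "\<And>x. x \<in> L \<Longrightarrow> G *\<^sub>V x \<in> L"
    and G: "contraction G" and c: "cmod c < 1" and w: "x + c *\<^sub>C (G *\<^sub>V x) \<in> L"
  shows "x \<in> L"
proof -
  let ?f = "\<lambda>y. (x + c *\<^sub>C (G *\<^sub>V x)) - c *\<^sub>C (G *\<^sub>V y)"
  have lip: "dist (?f y) (?f y') \<le> cmod c * dist y y'" for y y'
  proof -
    have "?f y - ?f y' = c *\<^sub>C (G *\<^sub>V (y' - y))"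
      by (simp add: cblinfun_linear scaleC_algebra)
    then have "dist (?f y) (?f y') = cmod c * norm (G *\<^sub>V (y' - y))"
      by (simp add: dist_norm norm_scaleC)
    also have "\<dots> \<le> cmod c * dist y y'"
      using G by (intro mult_left_mono) (auto simp: contraction_def dist_norm norm_minus_commute)
    finally show ?thesis .
  qed
  have "\<exists>!y\<in>L. ?f y = y"
  proof (rule Banach_fix)
    show "complete L" using L(1) by (simp add: complete_eq_closed)
    show "L \<noteq> {}" using complex_vector.subspace_0[OF L(2)] by blast
    show "?f ` L \<subseteq> L"
      using inv w L(2)
      by (auto intro!: complex_vector.subspace_diff complex_vector.subspace_scale)
  qed (use c lip in auto)
  then obtain y where y: "y \<in> L" "?f y = y" by blast
  \<comment> \<open>\<open>x\<close> is itself a fixed point of \<open>?f\<close>, so it must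
    coincide with the one found in \<open>L\<close>.\<close>
  have "dist x y \<le> cmod c * dist x y"
    using lip[of x y] y(2) by simp
  then have "(1 - cmod c) * dist x y \<le> 0" by (simp add: algebra_simps)
  then have "x = y" using c by (simp add: mult_le_0_iff)
  then show ?thesis using y by simp
qed

section \<open>The orthogonal state relation and the Moebius map\<close>

text \<open>The real matrix with rows (a, b) and (b, -a) is orthogonal, so the cross terms
  cancel.\<close>

lemma rotation_norm:
  fixes x y :: "'a::real_inner"
  assumes "a * a + b * b = 1"
  shows "(norm (a *\<^sub>R x + b *\<^sub>R y))\<^sup>2 + (norm (b *\<^sub>R x - a *\<^sub>R y))\<^sup>2 = (norm x)\<^sup>2 + (norm y)\<^sup>2"
proof -
  have "(norm (a *\<^sub>R x + b *\<^sub>R y))\<^sup>2 + (norm (b *\<^sub>R x - a *\<^sub>R y))\<^sup>2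
      = (a * a + b * b) * ((norm x)\<^sup>2 + (norm y)\<^sup>2)"
    unfolding power2_norm_eq_inner
    by (simp add: inner_add_left inner_add_right inner_diff_left inner_diff_right inner_commute
        algebra_simps)
  then show ?thesis using assms by simp
qed

text \<open>The inverse map has real coefficients, so a real value t with |t| \<ge> 1 could come
  only from the real point z = (t - a) / (1 - a t). The identity (1 - a t)^2 - (t - a)^2 = (1 - a^2)
  (1 - t^2) then contradicts |z| < 1.\<close>

lemma moebius_mem_\<E>:
  assumes "\<bar>a\<bar> < 1" "z \<in> \<E>"
  shows "1 + of_real a * z \<noteq> 0" "(z + of_real a) / (1 + of_real a * z) \<in> \<E>"
proof -
  have mult_less_1: "\<bar>a * x\<bar> < 1" if "\<bar>x\<bar> < 1" for x
    using assms(1) that by (metis abs_ge_zero abs_mult mult_strict_mono' mult_1)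
  show nz: "1 + of_real a * z \<noteq> 0"
  proof
    assume 0: "1 + of_real a * z = 0"
    then have "a * Im z = 0" "1 + a * Re z = 0" by (auto simp: complex_eq_iff)
    moreover from this(2) have "a \<noteq> 0" by auto
    ultimately show False using assms(2) mult_less_1[of "Re z"] by (auto simp: mem_\<E>_iff)
  qed
  show "(z + of_real a) / (1 + of_real a * z) \<in> \<E>"
  proof (rule ccontr)
    let ?\<zeta> = "(z + of_real a) / (1 + of_real a * z)"
    assume "?\<zeta> \<notin> \<E>"
    define t where "t = Re ?\<zeta>"
    have t: "?\<zeta> = of_real t" "1 \<le> \<bar>t\<bar>"
      using \<open>?\<zeta> \<notin> \<E>\<close> by (simp_all add: t_def mem_\<E>_iff complex_eq_iff)
    have "z + of_real a = of_real t * (1 + of_real a * z)"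
      using t(1) nz by (simp add: divide_eq_eq)
    then have z: "z * of_real (1 - a * t) = of_real (t - a)"
      by (simp add: algebra_simps)
    have "1 - a * t \<noteq> 0"
    proof
      assume 0: "1 - a * t = 0"
      then have "t = a" using z by simp
      then show False using assms(1) t(2) by simp
    qed
    then have "z = of_real ((t - a) / (1 - a * t))"
      using z by (metis nonzero_mult_div_cancel_right of_real_divide of_real_eq_0_iff)
    then have "\<bar>(t - a) / (1 - a * t)\<bar> < 1"
      using assms(2) by (simp add: mem_\<E>_iff del: of_real_divide)
    then have "\<bar>t - a\<bar> < \<bar>1 - a * t\<bar>"
      using \<open>1 - a * t \<noteq> 0\<close> by (simp add: divide_less_eq)
    then have "(t - a)\<^sup>2 < (1 - a * t)\<^sup>2"
      using power_strict_mono[of "\<bar>t - a\<bar>" "\<bar>1 - a * t\<bar>" 2] by simp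
    then have "(1 - a\<^sup>2) * (t\<^sup>2 - 1) < 0" by (simp add: power2_eq_square algebra_simps)
    moreover have "1 \<le> t\<^sup>2" "a\<^sup>2 < 1" using t(2) assms(1)
      by (simp_all add: abs_square_less_1 abs_le_square_iff[of 1 t, simplified])
    ultimately show False by (simp add: mult_less_0_iff)
  qed
qed

section \<open>The transformed system\<close>

theorem theorem6p11:
  fixes D :: "'m::chilbert_space \<Rightarrow>\<^sub>C\<^sub>L 'm"
    and C :: "'k::chilbert_space \<Rightarrow>\<^sub>C\<^sub>L 'm"
    and F F\<^sub>a :: "'k \<Rightarrow>\<^sub>C\<^sub>L 'k"
    and \<Omega> :: "complex \<Rightarrow> 'm \<Rightarrow>\<^sub>C\<^sub>L 'm"
    and \<tau> \<tau>\<^sub>a :: "('m, 'k) system"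
    and a :: real
  assumes "separable_space (euclidean :: 'm topology)"
    and "separable_space (euclidean :: 'k topology)"
    and "\<tau> = System D C (C*) F"
    and "passive_selfadjoint_system \<tau>"
    and "is_transfer_function \<Omega> \<tau>"
    and "a \<in> {-1<..<1}"
    and "F\<^sub>a = (F - of_real a *\<^sub>C id_cblinfun) o\<^sub>C\<^sub>L cblinfun_inv (id_cblinfun - of_real a *\<^sub>C F)"
    and "\<tau>\<^sub>a = System
      (\<Omega> (of_real a))
      (of_real (sqrt (1 - a\<^sup>2)) *\<^sub>C (C o\<^sub>C\<^sub>L cblinfun_inv (id_cblinfun - of_real a *\<^sub>C F)))
      (of_real (sqrt (1 - a\<^sup>2)) *\<^sub>C (cblinfun_inv (id_cblinfun - of_real a *\<^sub>C F) o\<^sub>C\<^sub>L C*))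
      F\<^sub>a"
  shows "passive_selfadjoint_system \<tau>\<^sub>a \<and>
    is_transfer_function (\<lambda>z. \<Omega> ((z + of_real a) / (1 + of_real a * z))) \<tau>\<^sub>a \<and>
    (minimal_system \<tau> \<longrightarrow> minimal_system \<tau>\<^sub>a)"
proof -
  let ?a = "complex_of_real a" and ?s = "sqrt (1 - a\<^sup>2)"
  let ?r = "complex_of_real ?s" and ?B = "C*"
  define R where "R = cblinfun_inv (id_cblinfun - ?a *\<^sub>C F)"
  have a: "\<bar>a\<bar> < 1" "a\<^sup>2 < 1" using assms(6) by (auto simp: abs_square_less_1 abs_less_iff)
  have "?s * ?s = 1 - a\<^sup>2" "?s \<noteq> 0" using a(2) by auto
  then have s: "a * a + ?s * ?s = 1" "?r \<noteq> 0" by (auto simp: power2_eq_square)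
  have r: "?r * ?r = 1 - ?a * ?a"
    using s(1) by (metis add_diff_cancel_left' of_real_1 of_real_diff of_real_mult)
  have \<tau>: "passive_selfadjoint_system (System D C ?B F)" using assms(3,4) by simp
  note F = passive_selfadjoint_systemD(2,3)[OF \<tau>]
  have a_mem: "?a \<in> \<E>" using a(1) by (simp add: mem_\<E>_iff)
  have R_left: "R *\<^sub>V (x - ?a *\<^sub>C (F *\<^sub>V x)) = x" for x
    unfolding R_def by (rule resolvent_left[OF F a_mem])
  have R_right: "R *\<^sub>V x - ?a *\<^sub>C (F *\<^sub>V R *\<^sub>V x) = x" for x
    unfolding R_def by (rule resolvent_right[OF F a_mem])
  have R_F: "R *\<^sub>V F *\<^sub>V x = F *\<^sub>V R *\<^sub>V x" for x
  proof -
    \<comment> \<open>This exhibits \<open>F x\<close> as I - a F applied to \<open>F R x\<close>;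
      applying \<open>R\<close> gives the commutation.\<close>
    have "F *\<^sub>V x = F *\<^sub>V R *\<^sub>V x - ?a *\<^sub>C (F *\<^sub>V F *\<^sub>V R *\<^sub>V x)"
      using arg_cong[OF R_right[of x], of "cblinfun_apply F"] by (simp add: cblinfun_linear)
    then show ?thesis using R_left by metis
  qed
  have \<Omega>: "\<Omega> z *\<^sub>V u = D *\<^sub>V u
      + z *\<^sub>C (C *\<^sub>V cblinfun_inv (id_cblinfun - z *\<^sub>C F) *\<^sub>V ?B *\<^sub>V u)" if "z \<in> \<E>" for z u
    using assms(3,5) that by (simp add: is_transfer_function_def cblinfun_rep_eqs)
  have \<Omega>_a: "\<Omega> ?a *\<^sub>V u = D *\<^sub>V u + ?a *\<^sub>C (C *\<^sub>V R *\<^sub>V ?B *\<^sub>V u)" for u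
    unfolding R_def by (rule \<Omega>[OF a_mem])
  have F\<^sub>a: "F\<^sub>a *\<^sub>V v = F *\<^sub>V R *\<^sub>V v - ?a *\<^sub>C (R *\<^sub>V v)" for v
    by (simp add: assms(7) R_def cblinfun_rep_eqs)
  let ?C\<^sub>a = "?r *\<^sub>C (C o\<^sub>C\<^sub>L R)" and ?B\<^sub>a = "?r *\<^sub>C (R o\<^sub>C\<^sub>L ?B)"
  have \<tau>\<^sub>a: "\<tau>\<^sub>a = System (\<Omega> ?a) ?C\<^sub>a ?B\<^sub>a F\<^sub>a" using assms(8) by (simp add: R_def)
  let ?T = "block_operator D C ?B F" and ?T\<^sub>a = "block_operator (\<Omega> ?a) ?C\<^sub>a ?B\<^sub>a F\<^sub>a"
  have T: "?T *\<^sub>V (u, x) = (D *\<^sub>V u + C *\<^sub>V x, ?B *\<^sub>V u + F *\<^sub>V x)" for u x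
    by (simp add: block_operator.rep_eq)
  have T\<^sub>a: "?T\<^sub>a *\<^sub>V (u, v) = (\<Omega> ?a *\<^sub>V u + ?r *\<^sub>C (C *\<^sub>V R *\<^sub>V v),
      ?r *\<^sub>C (R *\<^sub>V ?B *\<^sub>V u) + F\<^sub>a *\<^sub>V v)" for u v
    by (simp add: block_operator.rep_eq cblinfun_rep_eqs)
  define x where "x u v = R *\<^sub>V (?a *\<^sub>C (?B *\<^sub>V u) + ?r *\<^sub>C v)" for u v
  define p where "p u v = ?B *\<^sub>V u + F *\<^sub>V x u v" for u v
  have out: "fst (?T\<^sub>a *\<^sub>V (u, v)) = D *\<^sub>V u + C *\<^sub>V x u v" for u v
    by (simp add: T\<^sub>a \<Omega>_a x_def cblinfun_linear)
  have x: "x u v = ?a *\<^sub>C p u v + ?r *\<^sub>C v" for u v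
  proof -
    have "x u v - ?a *\<^sub>C (F *\<^sub>V x u v) = ?a *\<^sub>C (?B *\<^sub>V u) + ?r *\<^sub>C v"
      unfolding x_def by (rule R_right)
    then show ?thesis by (simp add: p_def scaleC_add_right algebra_simps)
  qed
  have state: "snd (?T\<^sub>a *\<^sub>V (u, v)) = ?r *\<^sub>C p u v - ?a *\<^sub>C v" for u v
  proof -
    let ?e = "R *\<^sub>V ?B *\<^sub>V u" and ?f = "F *\<^sub>V R *\<^sub>V v" and ?g = "R *\<^sub>V v"
    have "?B *\<^sub>V u + ?a *\<^sub>C (F *\<^sub>V ?e) = ?e"
      using R_right[of "?B *\<^sub>V u"] by (metis diff_add_cancel)
    then have "p u v = ?e + ?r *\<^sub>C ?f"
      by (simp add: p_def x_def cblinfun_linear flip: add.assoc)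
    moreover have "?a *\<^sub>C v = ?a *\<^sub>C ?g - ?a *\<^sub>C ?a *\<^sub>C ?f"
      by (metis R_right complex_vector.scale_right_diff_distrib)
    \<comment> \<open>In r p - a v the coefficient of \<open>?f\<close> is r^2 + a^2 = 1, which
      leaves r \<open>?e\<close> + \<open>?f\<close> - a \<open>?g\<close>, the state produced by
      \<open>?T\<^sub>a\<close>.\<close>
    ultimately show ?thesis
      by (simp add: T\<^sub>a F\<^sub>a scaleC_algebra r scaleC_one)
  qed

  \<comment> \<open>Passivity of \<open>\<tau>\<^sub>a\<close>\<close>
  have R_sym: "cinner (R *\<^sub>V x) y = cinner x (R *\<^sub>V y)" for x y
  proof -
    have "cinner (R *\<^sub>V x) y = cinner (R *\<^sub>V x) (R *\<^sub>V y - ?a *\<^sub>C (F *\<^sub>V R *\<^sub>V y))"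
      by (simp add: R_right)
    also have "\<dots> = cinner (R *\<^sub>V x - ?a *\<^sub>C (F *\<^sub>V R *\<^sub>V x)) (R *\<^sub>V y)"
      using F(1) by (simp add: cinner_algebra selfadjoint_iff)
    finally show ?thesis by (simp add: R_right)
  qed
  \<comment> \<open>Symmetry of \<open>R\<close> handles \<Omega>(a) and matches the two
    off-diagonal entries; \<open>F\<^sub>a\<close> also needs that \<open>R\<close> commutes with
    \<open>F\<close>.\<close>
  have "selfadjoint ?T\<^sub>a"
    unfolding selfadjoint_iff
    using passive_selfadjoint_systemD(1,2)[OF \<tau>, unfolded selfadjoint_iff]
    by (simp add: T\<^sub>a \<Omega>_a F\<^sub>a cinner_prod_def cinner_algebra R_sym R_F cinner_cadjoint[of C]
        cinner_cadjoint_left)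
  moreover have "contraction ?T\<^sub>a"
    unfolding contraction_def
  proof (intro allI power2_le_imp_le[OF _ norm_ge_zero])
    fix w :: "'m \<times> 'k"
    obtain u v where w: "w = (u, v)" by (cases w)
    let ?o = "D *\<^sub>V u + C *\<^sub>V x u v" and ?q = "?r *\<^sub>C p u v - ?a *\<^sub>C v"
    have norm_Pair2: "(norm (y, z))\<^sup>2 = (norm y)\<^sup>2 + (norm z)\<^sup>2" for y :: 'm and z :: 'k
      by (simp add: norm_Pair)
    have "norm (?T *\<^sub>V (u, x u v)) \<le> norm (u, x u v)"
      using \<tau> unfolding passive_selfadjoint_system_def contraction_def system_operator.simps
      by blast
    then have "(norm (?T *\<^sub>V (u, x u v)))\<^sup>2 \<le> (norm (u, x u v))\<^sup>2"
      by (intro power_mono) auto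
    then have "(norm ?o)\<^sup>2 + (norm (p u v))\<^sup>2 \<le> (norm u)\<^sup>2 + (norm (x u v))\<^sup>2"
      by (simp add: T norm_Pair2 p_def)
    moreover have "(norm (x u v))\<^sup>2 + (norm ?q)\<^sup>2 = (norm (p u v))\<^sup>2 + (norm v)\<^sup>2"
      using rotation_norm[OF s(1), of "p u v" v] by (simp add: x scaleR_scaleC)
    moreover have "?T\<^sub>a *\<^sub>V w = (?o, ?q)"
      using out state by (simp add: w prod_eq_iff)
    \<comment> \<open>Adding the contractivity inequality of \<tau> to the rotation identity cancels
      the norms of \<open>x u v\<close> and \<open>p u v\<close>.\<close>
    ultimately show "(norm (?T\<^sub>a *\<^sub>V w))\<^sup>2 \<le> (norm w)\<^sup>2"
      by (simp add: norm_Pair2 w)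
  qed
  ultimately have psv: "passive_selfadjoint_system \<tau>\<^sub>a"
    by (simp add: passive_selfadjoint_system_def \<tau>\<^sub>a)

  \<comment> \<open>Transfer function of \<open>\<tau>\<^sub>a\<close>\<close>
  note F\<^sub>a_sa = passive_selfadjoint_systemD(2,3)[OF psv[unfolded \<tau>\<^sub>a]]
  have "transfer_function \<tau>\<^sub>a z = \<Omega> ((z + ?a) / (1 + ?a * z))" if z: "z \<in> \<E>" for z
  proof (rule cblinfun_eqI)
    fix u
    define \<zeta> where "\<zeta> = (z + ?a) / (1 + ?a * z)"
    have \<zeta>: "\<zeta> \<in> \<E>" and nz: "1 + ?a * z \<noteq> 0"
      using moebius_mem_\<E>[OF a(1) z] by (simp_all add: \<zeta>_def)
    \<comment> \<open>The choice v = z q closes the feedback loop: \<open>\<tau>\<^sub>a\<close>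
      sends \<open>(u, v)\<close> to the state \<open>q\<close> again. The resolvent exists because
      \<open>F\<^sub>a\<close> has just been shown to be a selfadjoint contraction.\<close>
    define q where "q = cblinfun_inv (id_cblinfun - z *\<^sub>C F\<^sub>a) *\<^sub>V ?B\<^sub>a *\<^sub>V u"
    define v where "v = z *\<^sub>C q"
    have "q - z *\<^sub>C (F\<^sub>a *\<^sub>V q) = ?B\<^sub>a *\<^sub>V u"
      unfolding q_def by (rule resolvent_right[OF F\<^sub>a_sa z])
    then have "q = snd (?T\<^sub>a *\<^sub>V (u, v))"
      by (simp add: v_def block_operator.rep_eq cblinfun_linear algebra_simps)
    then have "q = ?r *\<^sub>C p u v - ?a *\<^sub>C z *\<^sub>C q"
      by (simp add: state v_def)
    then have q: "(1 + ?a * z) *\<^sub>C q = ?r *\<^sub>C p u v"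
      by (simp add: scaleC_algebra scaleC_one algebra_simps)
    \<comment> \<open>Substituting for \<open>q\<close>, the coefficient of \<open>p u v\<close>
      becomes (1 + a z) a + z (1 - a^2) = z + a.\<close>
    have "(1 + ?a * z) *\<^sub>C x u v = ((1 + ?a * z) * ?a) *\<^sub>C p u v + (?r * z) *\<^sub>C (1 + ?a * z) *\<^sub>C q"
      by (simp add: x v_def scaleC_add_right scaleC_scaleC mult_ac)
    also have "\<dots> = ((1 + ?a * z) * ?a + z * (?r * ?r)) *\<^sub>C p u v"
      unfolding q by (simp add: scaleC_add_left scaleC_scaleC mult_ac)
    also have "\<dots> = (1 + ?a * z) *\<^sub>C \<zeta> *\<^sub>C p u v"
    proof -
      have "(1 + ?a * z) * \<zeta> = z + ?a" using nz by (simp add: \<zeta>_def)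
      then show ?thesis unfolding r scaleC_scaleC by (simp add: algebra_simps)
    qed
    finally have x_eq: "x u v = \<zeta> *\<^sub>C p u v"
      using complex_vector.scale_left_imp_eq[OF nz] by blast
    \<comment> \<open>With x = \<zeta> p the definition of p reads p = \<open>?B\<close> u + \<zeta>
      F p, so p is the resolvent of \<tau> at \<zeta> applied to \<open>?B\<close> u.\<close>
    then have "?B *\<^sub>V u = p u v - \<zeta> *\<^sub>C (F *\<^sub>V p u v)"
      using p_def[of u v] by (metis add_diff_cancel_right' cblinfun_apply_scaleC)
    then have "cblinfun_inv (id_cblinfun - \<zeta> *\<^sub>C F) *\<^sub>V ?B *\<^sub>V u = p u v"
      using resolvent_left[OF F \<zeta>] by simp
    then have "\<Omega> \<zeta> *\<^sub>V u = D *\<^sub>V u + C *\<^sub>V x u v"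
      by (simp add: \<Omega>[OF \<zeta>] x_eq cblinfun_linear)
    also have "\<dots> = transfer_function \<tau>\<^sub>a z *\<^sub>V u"
      by (simp add: out[symmetric] T\<^sub>a \<tau>\<^sub>a v_def q_def cblinfun_rep_eqs cblinfun_linear
          scaleC_scaleC mult_ac)
    finally show "transfer_function \<tau>\<^sub>a z *\<^sub>V u = \<Omega> ((z + ?a) / (1 + ?a * z)) *\<^sub>V u"
      by (simp add: \<zeta>_def)
  qed
  then have transfer: "is_transfer_function (\<lambda>z. \<Omega> ((z + ?a) / (1 + ?a * z))) \<tau>\<^sub>a"
    by (simp add: is_transfer_function_def)

  \<comment> \<open>Minimality of \<open>\<tau>\<^sub>a\<close>\<close>
  have "minimal_system \<tau>\<^sub>a" if "minimal_system \<tau>"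
  proof -
    define S\<^sub>a where "S\<^sub>a = (\<Union>n::nat. range (\<lambda>u. (cblinfun_apply F\<^sub>a ^^ n) (?B\<^sub>a *\<^sub>V u)))"
    define L where "L = closure (cspan S\<^sub>a)"
    have L: "closed L" "complex_vector.subspace L"
      by (simp_all add: L_def subspace_closure_cspan)
    note L_intros = complex_vector.subspace_add[OF L(2)] complex_vector.subspace_diff[OF L(2)]
      complex_vector.subspace_scale[OF L(2)]
    have "F\<^sub>a *\<^sub>V y \<in> S\<^sub>a" if y: "y \<in> S\<^sub>a" for y
    proof -
      obtain n u where "y = (cblinfun_apply F\<^sub>a ^^ n) (?B\<^sub>a *\<^sub>V u)"
        using y unfolding S\<^sub>a_def by blast
      then have "F\<^sub>a *\<^sub>V y = (cblinfun_apply F\<^sub>a ^^ Suc n) (?B\<^sub>a *\<^sub>V u)" by simp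
      then show ?thesis unfolding S\<^sub>a_def by blast
    qed
    then have inv: "F\<^sub>a *\<^sub>V y \<in> L" if "y \<in> L" for y
      using that unfolding L_def by (rule invariant_closure_cspan)
    have R_eq: "y + ?a *\<^sub>C (F\<^sub>a *\<^sub>V y) = (?r * ?r) *\<^sub>C (R *\<^sub>V y)" for y
    proof -
      have "y + ?a *\<^sub>C (F\<^sub>a *\<^sub>V y)
          = (R *\<^sub>V y - ?a *\<^sub>C (F *\<^sub>V R *\<^sub>V y)) + ?a *\<^sub>C (F\<^sub>a *\<^sub>V y)"
        by (simp add: R_right)
      also have "\<dots> = (?r * ?r) *\<^sub>C (R *\<^sub>V y)"
        by (simp add: F\<^sub>a r scaleC_algebra scaleC_one)
      finally show ?thesis .
    qed
    \<comment> \<open>By \<open>R_eq\<close>, y + a \<open>F\<^sub>a\<close> y is a multiple of R y;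
      since |a| < 1 and \<open>F\<^sub>a\<close> is a contraction leaving \<open>L\<close>
      invariant, y can be recovered inside \<open>L\<close>.\<close>
    have R_cancel: "y \<in> L" if "R *\<^sub>V y \<in> L" for y
      using L inv F\<^sub>a_sa(2)
    proof (rule mem_invariant_subspace)
      show "cmod ?a < 1" using a(1) by simp
      show "y + ?a *\<^sub>C (F\<^sub>a *\<^sub>V y) \<in> L" unfolding R_eq using that by (rule L_intros)
    qed
    have R_inv: "R *\<^sub>V y \<in> L" if "y \<in> L" for y
    proof -
      have "(?r * ?r) *\<^sub>C (R *\<^sub>V y) \<in> L"
        unfolding R_eq[symmetric] using that inv by (intro L_intros)
      then have "inverse (?r * ?r) *\<^sub>C (?r * ?r) *\<^sub>C (R *\<^sub>V y) \<in> L" by (rule L_intros)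
      moreover have "inverse (?r * ?r) * (?r * ?r) = 1" using s(2) by (metis left_inverse mult_eq_0_iff)
      ultimately show ?thesis by (metis scaleC_scaleC scaleC_one)
    qed
    have F_inv: "F *\<^sub>V y \<in> L" if "y \<in> L" for y
    proof (rule R_cancel)
      \<comment> \<open>\<open>F\<^sub>a\<close> = F R - a R and the commutation turn R F into an
        expression in operators that leave \<open>L\<close> invariant.\<close>
      have "R *\<^sub>V F *\<^sub>V y = F\<^sub>a *\<^sub>V y + ?a *\<^sub>C (R *\<^sub>V y)" by (simp add: F\<^sub>a R_F)
      then show "R *\<^sub>V F *\<^sub>V y \<in> L" using that inv R_inv by (auto intro: L_intros)
    qed
    have B_mem: "?B *\<^sub>V u \<in> L" for u
    proof (rule R_cancel)
      \<comment> \<open>The generators with n = 0 are r R \<open>?B\<close> u; the nonzero factor r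
        is divided out before \<open>R\<close> is cancelled.\<close>
      have "(cblinfun_apply F\<^sub>a ^^ 0) (?B\<^sub>a *\<^sub>V u) \<in> S\<^sub>a" unfolding S\<^sub>a_def by blast
      then have "?B\<^sub>a *\<^sub>V u \<in> L"
        unfolding L_def using closure_subset complex_vector.span_base by fastforce
      then have "inverse ?r *\<^sub>C (?B\<^sub>a *\<^sub>V u) \<in> L" by (rule L_intros)
      then show "R *\<^sub>V ?B *\<^sub>V u \<in> L"
        using s(2) by (simp add: cblinfun_rep_eqs scaleC_scaleC scaleC_one)
    qed
    have "(cblinfun_apply F ^^ n) (?B *\<^sub>V u) \<in> L" for n u
      by (induction n) (simp_all add: B_mem F_inv)
    then have "closure (cspan (\<Union>n::nat. range (\<lambda>u. (cblinfun_apply F ^^ n) (?B *\<^sub>V u)))) \<subseteq> L"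
      using L by (intro closure_minimal complex_vector.span_minimal) auto
    then have "L = UNIV" using that by (auto simp: assms(3))
    then show ?thesis by (simp add: \<tau>\<^sub>a L_def S\<^sub>a_def)
  qed
  then show ?thesis using psv transfer by blast
qed

end
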